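(* Let $X$ be a tree-shift over a finite alphabet $\mathcal{A}$. Then for every $m\in\mathbb{N}$ ($m\ge 1$), the tree-shifts $X$ and $X^{[m]}$ are conjugate, where $X^{[m]}$ is the $m$th higher block tree-shift of $X$.
   Context: Let $\Sigma=\{0,1\}$, let $\Sigma^n$ be the set of words of length $n$ over $\Sigma$ ($\Sigma^0=\{\epsilon\}$, with $\epsilon$ the empty word), $\Sigma^*=\bigcup_{n\ge 0}\Sigma^n$, and $\Sigma_n=\bigcup_{k=0}^n\Sigma^k$. A (infinite) tree over a finite alphabet $\mathcal{A}$ is a function $t:\Sigma^*\to\mathcal{A}$; write $t_x=t(x)$. For $i\in\Sigma$ the shift map $\sigma_i$ is $(\sigma_i t)_x=t_{ix}$. A pattern is a function $u:L\to\mathcal{A}$ with $L\subset\Sigma^*$ finite and prefix-closed (the support of $u$); $u$ is a pattern of a tree $t$ rooted at $x\in\Sigma^*$ if $u_y=t_{xy}$ for all $y\in L$, and $t$ avoids $u$ if $u$ is not a pattern of $t$ rooted at any node. A tree-shift is a set of trees of the form $X=\mathsf{X}_{\mathcal{F}}=\{t: t \text{ avoids every } u\in\mathcal{F}\}$ for some collection $\mathcal{F}$ of patterns. An $n$-block is a pattern with support $\Sigma_{n-1}$; $B_n(X)$ is the set of all $n$-blocks that are patterns of some tree in $X$. Sliding block code: for tree-shifts $X$ over $\mathcal{A}$ and $Y$ over $\mathcal{A}'$, a map $\phi:X\to Y$ is a sliding block code if there are a positive integer $k$ and a map $\Phi:B_k(X)\to\mathcal{A}'$ such that, for all $t\in X$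 and $x\in\Sigma^*$, $\phi(t)_x=\Phi(u)$, where $u$ is the $k$-block of $t$ rooted at $x$. $X$ and $Y$ are conjugate if there is a sliding block code $\phi:X\to Y$ that has an inverse $\psi:Y\to X$ which is also a sliding block code. Higher block tree-shift: for $m\ge 1$ let $\mathcal{A}'=B_m(X)$ and define $\phi_m:X\to(\mathcal{A}')^{\Sigma^*}$ by letting $\phi_m(t)_x$ be the $m$-block of $t$ rooted at $x$. Then $X^{[m]}=\phi_m(X)$. *)

theory Defs
  imports "HOL-Library.FuncSet" "HOL-Library.Sublist"
begin

(* The binary alphabet {0, 1} is rendered as bool, so the nodes of the infinite binary
   tree are the words of type bool list: the empty word is [] and concatenation is @. *)

type_synonym word = "bool list"
type_synonym 'a tree = "word \<Rightarrow> 'a"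

(* A function u : L -> A with L a set of words is a partial map with dom u = L. *)

type_synonym 'a pattern = "word \<rightharpoonup> 'a"

definition words_upto :: "nat \<Rightarrow> word set" where
  "words_upto n = {x. length x \<le> n}"

definition trees :: "'a set \<Rightarrow> 'a tree set" where
  "trees A = (UNIV \<rightarrow> A)"

definition prefix_closed :: "word set \<Rightarrow> bool" where
  "prefix_closed L \<longleftrightarrow> (\<forall>y\<in>L. \<forall>x. prefix x y \<longrightarrow> x \<in> L)"

definition patterns :: "'a set \<Rightarrow> 'a pattern set" where
  "patterns A = {u. finite (dom u) \<and> prefix_closed (dom u) \<and> ran u \<subseteq> A}"

definition pattern_rooted_at :: "'a pattern \<Rightarrow> 'a tree \<Rightarrow> word \<Rightarrow> bool" where
  "pattern_rooted_at u t x \<longleftrightarrow> (\<forall>y\<in>dom u. u y = Some (t (x @ y)))"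

definition avoids :: "'a tree \<Rightarrow> 'a pattern \<Rightarrow> bool" where
  "avoids t u \<longleftrightarrow> (\<nexists>x. pattern_rooted_at u t x)"

definition avoiding_trees :: "'a set \<Rightarrow> 'a pattern set \<Rightarrow> 'a tree set" where
  "avoiding_trees A F = {t \<in> trees A. \<forall>u\<in>F. avoids t u}"

(* The alphabet A is allowed to be empty: the higher block tree-shift of the empty
   tree-shift has an empty alphabet. *)

definition tree_shift :: "'a set \<Rightarrow> 'a tree set \<Rightarrow> bool" where
  "tree_shift A X \<longleftrightarrow> finite A \<and> (\<exists>F. F \<subseteq> patterns A \<and> X = avoiding_trees A F)"

(* blocks and block_at are only meaningful for n > 0 (n - 1 is truncated at n = 0). *)

definition blocks :: "nat \<Rightarrow> 'a tree set \<Rightarrow> 'a pattern set" where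
  "blocks n X = {u. dom u = words_upto (n - 1) \<and> (\<exists>t\<in>X. \<exists>x. pattern_rooted_at u t x)}"

definition block_at :: "nat \<Rightarrow> 'a tree \<Rightarrow> word \<Rightarrow> 'a pattern" where
  "block_at n t x = (\<lambda>y. Some (t (x @ y))) |` words_upto (n - 1)"

(* Maps between tree-shifts are total functions of which only the values on the domain
   tree-shift matter; likewise for the local map f on blocks k X. *)

definition sliding_block_code ::
  "'a set \<Rightarrow> 'a tree set \<Rightarrow> 'b set \<Rightarrow> 'b tree set \<Rightarrow> ('a tree \<Rightarrow> 'b tree) \<Rightarrow> bool" where
  "sliding_block_code A X A' Y \<phi> \<longleftrightarrow>
     tree_shift A X \<and> tree_shift A' Y \<and> \<phi> \<in> X \<rightarrow> Y \<and>
     (\<exists>k>0. \<exists>f \<in> blocks k X \<rightarrow> A'. \<forall>t\<in>X. \<forall>x. \<phi> t x = f (block_at k t x))"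

definition conjugate :: "'a set \<Rightarrow> 'a tree set \<Rightarrow> 'b set \<Rightarrow> 'b tree set \<Rightarrow> bool" where
  "conjugate A X A' Y \<longleftrightarrow>
     (\<exists>\<phi> \<psi>. sliding_block_code A X A' Y \<phi> \<and> sliding_block_code A' Y A X \<psi> \<and>
        (\<forall>t\<in>X. \<psi> (\<phi> t) = t) \<and> (\<forall>s\<in>Y. \<phi> (\<psi> s) = s))"

(* The tree x |-> block_at m t x over the alphabet blocks m X, for t in X. *)

definition higher_block_map :: "nat \<Rightarrow> 'a tree \<Rightarrow> 'a pattern tree" where
  "higher_block_map m t = block_at m t"

definition higher_block_shift :: "nat \<Rightarrow> 'a tree set \<Rightarrow> 'a pattern tree set" where
  "higher_block_shift m X = higher_block_map m ` X"

end

(* The only substantial point is that the higher block trees form a tree-shift. Forbid every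
   pattern that occurs in none of them. If each finite pattern of s occurs in a higher block
   tree, then the tree t of root symbols of s avoids what X avoids, because each of its finite
   patterns occurs in X; and comparing patterns of s on the support of an m-block shows that
   s is the higher block tree of t. Reading off root symbols is then the inverse code. *)

theory Submission
  imports Defs
begin

lemma finite_words_upto: "finite (words_upto n)"
  using finite_lists_length_le[of "UNIV :: bool set" n] by (simp add: words_upto_def)

lemma prefix_closed_words_upto: "prefix_closed (words_upto n)"
  by (auto simp: prefix_closed_def words_upto_def dest: prefix_length_le)

lemma Nil_in_words_upto: "[] \<in> words_upto n"
  by (simp add: words_upto_def)

lemma dom_block_at: "dom (block_at n t x) = words_upto (n - 1)"
  by (auto simp: block_at_def dom_def restrict_map_def)

lemma block_at_apply: "y \<in> words_upto (n - 1) \<Longrightarrow> block_at n t x y = Some (t (x @ y))"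
  by (simp add: block_at_def)

lemma block_at_Nil: "block_at n t x [] = Some (t x)"
  by (simp add: block_at_apply Nil_in_words_upto)

lemma block_at_eqI:
  assumes "dom u = words_upto (n - 1)"
    and "\<And>y. y \<in> words_upto (n - 1) \<Longrightarrow> u y = Some (t (x @ y))"
  shows "u = block_at n t x"
proof
  fix y
  show "u y = block_at n t x y"
    using assms by (cases "y \<in> words_upto (n - 1)") (auto simp: block_at_def domIff)
qed

text \<open>The support and one occurrence determine a block, so it equals
  \<open>block_at n t x\<close> for any place where it occurs. This replaces occurrence by an
  equation.\<close>

lemma blocks_eq: "blocks n X = {block_at n t x | t x. t \<in> X}"
proof (intro set_eqI iffI)
  fix u
  assume "u \<in> blocks n X"
  then obtain t x where "dom u = words_upto (n - 1)" "t \<in> X" "pattern_rooted_at u t x"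
    by (auto simp: blocks_def)
  then have "u = block_at n t x"
    by (intro block_at_eqI) (auto simp: pattern_rooted_at_def)
  with \<open>t \<in> X\<close> show "u \<in> {block_at n t x | t x. t \<in> X}"
    by blast
next
  fix u
  assume "u \<in> {block_at n t x | t x. t \<in> X}"
  then obtain t x where u: "u = block_at n t x" and "t \<in> X"
    by blast
  have "pattern_rooted_at u t x"
    unfolding pattern_rooted_at_def u dom_block_at by (blast intro: block_at_apply)
  with \<open>t \<in> X\<close> show "u \<in> blocks n X"
    using dom_block_at[of n t x] unfolding blocks_def u by blast
qed

lemma block_at_in_blocks: "t \<in> X \<Longrightarrow> block_at n t x \<in> blocks n X"
  by (auto simp: blocks_eq)

lemma tree_shift_subset_trees: "tree_shift A X \<Longrightarrow> X \<subseteq> trees A"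
  by (auto simp: tree_shift_def avoiding_trees_def)

text \<open>Blocks are maps from a fixed finite support into a finite alphabet. Finiteness is
  required because the m-blocks become the new alphabet.\<close>

lemma finite_blocks:
  assumes "finite A" "X \<subseteq> trees A"
  shows "finite (blocks n X)"
proof (rule finite_subset)
  show "blocks n X \<subseteq> {u. dom u = words_upto (n - 1) \<and> ran u \<subseteq> A}"
    using assms(2)
    by (force simp: blocks_eq dom_block_at ran_def block_at_def restrict_map_def trees_def
        split: if_splits)
  show "finite {u. dom u = words_upto (n - 1) \<and> ran u \<subseteq> A}"
    by (rule finite_set_of_finite_maps) (simp_all add: finite_words_upto assms(1))
qed

text \<open>A forbidden pattern occurring in \<open>t\<close> at \<open>x\<close> would, by
  \<open>loc\<close> for its support, also occur in some tree of \<open>X\<close>.\<close>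

lemma tree_shift_memI:
  assumes X: "tree_shift A X" and t: "t \<in> trees A"
    and loc: "\<And>L x. finite L \<Longrightarrow> prefix_closed L \<Longrightarrow>
      \<exists>t'\<in>X. \<exists>x'. \<forall>y\<in>L. t (x @ y) = t' (x' @ y)"
  shows "t \<in> X"
proof -
  obtain F where F: "F \<subseteq> patterns A" and X_eq: "X = avoiding_trees A F"
    using X by (auto simp: tree_shift_def)
  have "avoids t u" if "u \<in> F" for u
  proof (rule ccontr)
    assume "\<not> avoids t u"
    then obtain x where x: "pattern_rooted_at u t x"
      by (auto simp: avoids_def)
    have "finite (dom u)" "prefix_closed (dom u)"
      using F that by (auto simp: patterns_def)
    from loc[OF this, of x] obtain t' x' where t': "t' \<in> X"
      and eq: "\<forall>y\<in>dom u. t (x @ y) = t' (x' @ y)"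
      by blast
    have "pattern_rooted_at u t' x'"
      using x eq by (simp add: pattern_rooted_at_def)
    moreover have "avoids t' u"
      using t' that X_eq by (auto simp: avoiding_trees_def)
    ultimately show False
      by (auto simp: avoids_def)
  qed
  with t show ?thesis
    by (auto simp: X_eq avoiding_trees_def)
qed

text \<open>Together with \<open>tree_shift_memI\<close> this makes being a tree-shift a local
  closure property, free of any choice of forbidden patterns. For \<open>F\<close> the largest
  candidate serves.\<close>

lemma tree_shiftI:
  assumes fin: "finite A" and sub: "X \<subseteq> trees A"
    and loc: "\<And>t. t \<in> trees A \<Longrightarrow>
      (\<And>L x. finite L \<Longrightarrow> prefix_closed L \<Longrightarrow>
        \<exists>t'\<in>X. \<exists>x'. \<forall>y\<in>L. t (x @ y) = t' (x' @ y)) \<Longrightarrow> t \<in> X"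
  shows "tree_shift A X"
proof -
  define F where "F = {u \<in> patterns A. \<forall>t\<in>X. avoids t u}"
  have "t \<in> X" if t: "t \<in> avoiding_trees A F" for t
  proof (rule loc)
    show tA: "t \<in> trees A"
      using t by (simp add: avoiding_trees_def)
    fix L :: "word set" and x :: word
    assume L: "finite L" "prefix_closed L"
    \<comment> \<open>The pattern of \<open>t\<close> at \<open>x\<close> on \<open>L\<close> is not
      avoided by \<open>t\<close>, so it lies outside \<open>F\<close> and hence must occur in
      \<open>X\<close>.\<close>
    define u where "u = (\<lambda>y. Some (t (x @ y))) |` L"
    have dom_u: "dom u = L"
      by (auto simp: u_def dom_def restrict_map_def)
    have "ran u \<subseteq> A"
      using tA by (auto simp: u_def ran_def restrict_map_def trees_def split: if_splits)
    then have "u \<in> patterns A"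
      using L by (simp add: patterns_def dom_u)
    moreover have "\<not> avoids t u"
      by (auto simp: avoids_def pattern_rooted_at_def dom_u) (auto simp: u_def)
    ultimately obtain t' where "t' \<in> X" "\<not> avoids t' u"
      using t by (auto simp: F_def avoiding_trees_def)
    then obtain x' where "pattern_rooted_at u t' x'"
      by (auto simp: avoids_def)
    then have "\<forall>y\<in>L. t (x @ y) = t' (x' @ y)"
      by (simp add: pattern_rooted_at_def dom_u) (simp add: u_def)
    with \<open>t' \<in> X\<close> show "\<exists>t'\<in>X. \<exists>x'. \<forall>y\<in>L. t (x @ y) = t' (x' @ y)"
      by blast
  qed
  moreover have "X \<subseteq> avoiding_trees A F"
    using sub by (auto simp: F_def avoiding_trees_def)
  ultimately have "X = avoiding_trees A F"
    by blast
  moreover have "F \<subseteq> patterns A"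
    by (auto simp: F_def)
  ultimately show ?thesis
    using fin by (auto simp: tree_shift_def)
qed

text \<open>The candidate inverse of \<open>higher_block_map\<close>. The outer \<open>the\<close>
  is harmless where it matters, since the support of every block contains the empty word.\<close>

definition root_symbols :: "'a pattern tree \<Rightarrow> 'a tree" where
  "root_symbols s x = the (s x [])"

lemma root_symbols_higher_block_map: "root_symbols (higher_block_map m t) = t"
  by (rule ext) (simp add: root_symbols_def higher_block_map_def block_at_Nil)

lemma tree_shift_higher_block_shift:
  assumes X: "tree_shift A X"
  shows "tree_shift (blocks m X) (higher_block_shift m X)"
proof (rule tree_shiftI)
  show "finite (blocks m X)"
    using X tree_shift_subset_trees[OF X] by (intro finite_blocks) (auto simp: tree_shift_def)
  show "higher_block_shift m X \<subseteq> trees (blocks m X)"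
    by (auto simp: higher_block_shift_def higher_block_map_def trees_def block_at_in_blocks)
next
  fix s
  assume s: "s \<in> trees (blocks m X)"
    and loc: "\<And>L x. finite L \<Longrightarrow> prefix_closed L \<Longrightarrow>
      \<exists>s'\<in>higher_block_shift m X. \<exists>x'. \<forall>y\<in>L. s (x @ y) = s' (x' @ y)"
  have loc_X: "\<exists>t\<in>X. \<exists>x'. \<forall>y\<in>L. s (x @ y) = block_at m t (x' @ y)"
    if "finite L" "prefix_closed L" for L x
    using loc[OF that, of x] by (auto simp: higher_block_shift_def higher_block_map_def)
  define t where "t = root_symbols s"
  \<comment> \<open>Transfers any agreement of \<open>s\<close> with a higher block tree to an
    agreement of \<open>t\<close> with the underlying tree.\<close>
  have t_eq: "t x = t' x'" if "s x = block_at m t' x'" for x t' x'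
    using that by (simp add: t_def root_symbols_def block_at_Nil)
  have "t \<in> X"
  proof (rule tree_shift_memI[OF X])
    have "t x \<in> A" for x
    proof -
      obtain t' x' where "t' \<in> X" "s x = block_at m t' x'"
        using s unfolding trees_def blocks_eq by blast
      then show ?thesis
        using t_eq[of x t' x'] tree_shift_subset_trees[OF X] unfolding trees_def by auto
    qed
    then show "t \<in> trees A"
      by (simp add: trees_def)
    show "\<exists>t'\<in>X. \<exists>x'. \<forall>y\<in>L. t (x @ y) = t' (x' @ y)"
      if "finite L" "prefix_closed L" for L x
      using loc_X[OF that, of x] t_eq by blast
  qed
  moreover have "s x = block_at m t x" for x
  proof -
    \<comment> \<open>Taking \<open>L\<close> to be the support of an m-block yields one tree
      \<open>t'\<close> and one node \<open>x'\<close> for all \<open>y\<close> at once. The empty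
      word identifies \<open>s x\<close> as a block of \<open>t'\<close>; by \<open>t_eq\<close> the
      other nodes show that \<open>t\<close> has this same block at \<open>x\<close>.\<close>
    obtain t' x' where eq: "\<forall>y\<in>words_upto (m - 1). s (x @ y) = block_at m t' (x' @ y)"
      using loc_X[OF finite_words_upto prefix_closed_words_upto] by blast
    then have "s x = block_at m t' x'"
      using Nil_in_words_upto by fastforce
    moreover have "t (x @ y) = t' (x' @ y)" if "y \<in> words_upto (m - 1)" for y
      using eq that t_eq by blast
    ultimately show ?thesis
      by (intro block_at_eqI) (simp_all add: dom_block_at block_at_apply)
  qed
  ultimately show "s \<in> higher_block_shift m X"
    by (auto simp: higher_block_shift_def higher_block_map_def)
qed

lemma sliding_block_code_higher_block_map:
  assumes "tree_shift A X" "m \<ge> 1"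
  shows "sliding_block_code A X (blocks m X) (higher_block_shift m X) (higher_block_map m)"
proof -
  have "\<exists>k>0. \<exists>f \<in> blocks k X \<rightarrow> blocks m X. \<forall>t\<in>X. \<forall>x. higher_block_map m t x = f (block_at k t x)"
    \<comment> \<open>The window is \<open>m\<close> and the local map the identity, as the m-block
      itself is the new symbol; \<open>m \<ge> 1\<close> makes the window positive.\<close>
    using assms(2) by (intro exI[of _ m] conjI bexI[of _ id]) (auto simp: higher_block_map_def)
  then show ?thesis
    using assms(1) tree_shift_higher_block_shift[OF assms(1)]
    by (simp add: sliding_block_code_def higher_block_shift_def)
qed

lemma sliding_block_code_root_symbols:
  assumes "tree_shift A X"
  shows "sliding_block_code (blocks m X) (higher_block_shift m X) A X root_symbols"
proof -
  \<comment> \<open>The window is 1: the inner \<open>the\<close> extracts the only symbol of a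
    1-block, which is itself an m-block, and the outer one its root symbol.\<close>
  define f :: "'a pattern pattern \<Rightarrow> 'a" where "f u = the (the (u []) [])" for u
  have f: "f (block_at 1 s x) = root_symbols s x" for s x
    by (simp add: f_def root_symbols_def block_at_Nil)
  have maps: "root_symbols s \<in> X" if "s \<in> higher_block_shift m X" for s
    using that by (auto simp: higher_block_shift_def root_symbols_higher_block_map)
  have "f \<in> blocks 1 (higher_block_shift m X) \<rightarrow> A"
  proof
    fix u
    assume "u \<in> blocks 1 (higher_block_shift m X)"
    then obtain s x where "s \<in> higher_block_shift m X" "u = block_at 1 s x"
      by (auto simp: blocks_eq)
    then show "f u \<in> A"
      using maps[of s] f[of s x] tree_shift_subset_trees[OF assms] by (auto simp: trees_def)
  qed
  then have "\<exists>k>0. \<exists>f \<in> blocks k (higher_block_shift m X) \<rightarrow> A.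
      \<forall>s\<in>higher_block_shift m X. \<forall>x. root_symbols s x = f (block_at k s x)"
    using f by (intro exI[of _ 1] conjI bexI[of _ f]) simp_all
  then show ?thesis
    using assms tree_shift_higher_block_shift[OF assms] maps
    by (auto simp: sliding_block_code_def)
qed

theorem theorem2p4:
  fixes A :: "'a set" and X :: "'a tree set" and m :: nat
  assumes "tree_shift A X" and "m \<ge> 1"
  shows "conjugate A X (blocks m X) (higher_block_shift m X)"
  unfolding conjugate_def
proof (intro exI conjI)
  show "sliding_block_code A X (blocks m X) (higher_block_shift m X) (higher_block_map m)"
    using assms by (rule sliding_block_code_higher_block_map)
  show "sliding_block_code (blocks m X) (higher_block_shift m X) A X root_symbols"
    using assms(1) by (rule sliding_block_code_root_symbols)
\<comment> \<open>Both inverse laws follow from the one left inverse identity, since every tree of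
  the higher block shift is an image under \<open>higher_block_map m\<close>.\<close>
qed (auto simp: higher_block_shift_def root_symbols_higher_block_map)

end
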